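(* Let $E$ be a nonsingular elliptic curve over $\mathbb{Q}$ and let $p$ be a prime at which $E$ has good ordinary reduction. Let $\tau,\overline{\tau}\in\mathbb{C}$ be the complex conjugate Frobenius eigenvalues of the reduction of $E$ at $p$, so that $\tau\overline{\tau}=p$ and $\tau^n+\overline{\tau}^n=p^n+1-\#E(\mathbb{F}_{p^n})$ for all $n\ge 1$. Then the sequence of normalized traces of Frobenius $$\alpha_n=\frac{\tau^n+\overline{\tau}^n}{2p^{n/2}},\qquad n\ge 1,$$ is dense in the interval $[-1,1]$ but is not equidistributed on $[-1,1]$.
   Context: The prime $p$ is fixed and $n$ varies over the positive integers. $\#E(\mathbb{F}_{p^n})$ denotes the number of $\mathbb{F}_{p^n}$-rational points (including the point at infinity) of the reduction of $E$ modulo $p$. Good ordinary reduction means that the reduced curve over $\mathbb{F}_p$ is nonsingular and $p\nmid p+1-\#E(\mathbb{F}_p)$. Writing $\tau=p^{1/2}e^{i\theta}$ with $\theta\in[0,\pi]$, one has $\alpha_n=\cos n\theta$. A sequence $(x_n)_{n\ge1}$ in $[-1,1]$ is equidistributed on $[-1,1]$ if for every subinterval $[a,b]\subseteq[-1,1]$, $\lim_{N\to\infty}\frac{1}{N}\#\{n\le N: x_n\in[a,b]\}=\frac{b-a}{2}$, that is, equidistributed with respect to normalized Lebesgue measure. *)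

theory Defs
  imports "HOL-Analysis.Analysis" "HOL-Computational_Algebra.Fundamental_Theorem_Algebra"
begin

(* Weierstrass a1 a2 a3 a4 a6 is the projective plane cubic with affine equation
     y^2 + a1 x y + a3 y = x^3 + a2 x^2 + a4 x + a6
   together with its single point at infinity [0:1:0], which is always a smooth point. *)
datatype 'a weierstrass = Weierstrass 'a 'a 'a 'a 'a

fun weierstrass_poly :: "'a::comm_ring_1 weierstrass \<Rightarrow> 'a \<Rightarrow> 'a \<Rightarrow> 'a" where
  "weierstrass_poly (Weierstrass a1 a2 a3 a4 a6) x y =
     y^2 + a1 * x * y + a3 * y - (x^3 + a2 * x^2 + a4 * x + a6)"

fun weierstrass_poly_dx :: "'a::comm_ring_1 weierstrass \<Rightarrow> 'a \<Rightarrow> 'a \<Rightarrow> 'a" where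
  "weierstrass_poly_dx (Weierstrass a1 a2 a3 a4 a6) x y =
     a1 * y - (3 * x^2 + 2 * a2 * x + a4)"

fun weierstrass_poly_dy :: "'a::comm_ring_1 weierstrass \<Rightarrow> 'a \<Rightarrow> 'a \<Rightarrow> 'a" where
  "weierstrass_poly_dy (Weierstrass a1 a2 a3 a4 a6) x y = 2 * y + a1 * x + a3"

(* The coefficients are taken in an algebraically closed field, so this is geometric
   nonsingularity; a curve over a smaller field must be mapped to a closed field first. *)
definition nonsingular :: "'a::alg_closed_field weierstrass \<Rightarrow> bool" where
  "nonsingular C \<longleftrightarrow>
     (\<nexists>x y. weierstrass_poly C x y = 0 \<and>
            weierstrass_poly_dx C x y = 0 \<and> weierstrass_poly_dy C x y = 0)"

fun discriminant :: "'a::comm_ring_1 weierstrass \<Rightarrow> 'a" where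
  "discriminant (Weierstrass a1 a2 a3 a4 a6) =
     (let b2 = a1^2 + 4 * a2;
          b4 = 2 * a4 + a1 * a3;
          b6 = a3^2 + 4 * a6;
          b8 = a1^2 * a6 + 4 * a2 * a6 - a1 * a3 * a4 + a2 * a3^2 - a4^2
      in - (b2^2) * b8 - 8 * b4^3 - 27 * b6^2 + 9 * b2 * b4 * b6)"

(* W arises from E by an admissible change of variables over the rationals.  As the field of
   rationals is infinite, the identity of values is an identity of polynomials. *)
definition isomorphic_models :: "rat weierstrass \<Rightarrow> rat weierstrass \<Rightarrow> bool" where
  "isomorphic_models E W \<longleftrightarrow>
     (\<exists>u r s t. u \<noteq> 0 \<and>
        (\<forall>x y. weierstrass_poly E (u^2 * x + r) (u^3 * y + u^2 * s * x + t) =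
               u^6 * weierstrass_poly W x y))"

definition p_integral :: "nat \<Rightarrow> rat \<Rightarrow> bool" where
  "p_integral p a \<longleftrightarrow> \<not> int p dvd snd (quotient_of a)"

definition p_integral_model :: "nat \<Rightarrow> rat weierstrass \<Rightarrow> rat weierstrass \<Rightarrow> bool" where
  "p_integral_model p E W \<longleftrightarrow>
     isomorphic_models E W \<and> (\<forall>a\<in>set_weierstrass W. p_integral p a)"

(* A minimal Weierstrass model of E at p.  The discriminant of a p-integral model is p-integral,
   so its p-adic valuation is the multiplicity of p in the numerator.  Minimal models exist
   (lemma minimal_model_works below), and any two have isomorphic reductions. *)
definition minimal_model :: "nat \<Rightarrow> rat weierstrass \<Rightarrow> rat weierstrass" where
  "minimal_model p E =
     (ARG_MIN (\<lambda>W. multiplicity (int p) (fst (quotient_of (discriminant W)))) W.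
        p_integral_model p E W)"

(* Meaningful for p-integral a and 'k of characteristic p, where the denominator is nonzero. *)
definition reduce_rat :: "rat \<Rightarrow> 'k::field" where
  "reduce_rat a = of_int (fst (quotient_of a)) / of_int (snd (quotient_of a))"

(* The reduction of E modulo p, its coefficients (in the prime field) being viewed inside an
   arbitrary algebraically closed field 'k of characteristic p, for instance the type
   alg_closure of HOL-Algebra over a field with p elements. *)
definition reduction :: "nat \<Rightarrow> rat weierstrass \<Rightarrow> 'k::field weierstrass" where
  "reduction p E = map_weierstrass reduce_rat (minimal_model p E)"

(* For q a positive power of the characteristic this is the unique subfield with q
   elements (lemma card_finite_subfield below). *)
definition finite_subfield :: "nat \<Rightarrow> 'k::field set" where
  "finite_subfield q = {x. x ^ q = x}"

(* The summand 1 accounts for the point at infinity. *)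
definition num_points :: "nat \<Rightarrow> 'k::field weierstrass \<Rightarrow> nat" where
  "num_points q C =
     card {(x, y). x \<in> finite_subfield q \<and> y \<in> finite_subfield q \<and> weierstrass_poly C x y = 0} + 1"

definition good_ordinary :: "nat \<Rightarrow> 'k::alg_closed_field weierstrass \<Rightarrow> bool" where
  "good_ordinary p C \<longleftrightarrow>
     nonsingular C \<and> \<not> int p dvd (int p + 1 - int (num_points p C))"

definition equidistributed :: "(nat \<Rightarrow> real) \<Rightarrow> bool" where
  "equidistributed x \<longleftrightarrow>
     (\<forall>a b. -1 \<le> a \<and> a \<le> b \<and> b \<le> 1 \<longrightarrow>
        (\<lambda>N. real (card {n \<in> {1..N}. x n \<in> {a..b}}) / real N) \<longlonglongrightarrow> (b - a) / 2)"

lemma card_finite_subfield: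
  assumes "prime CHAR('k::alg_closed_field)" "n \<ge> 1"
  shows "card (finite_subfield (CHAR('k) ^ n) :: 'k set) = CHAR('k) ^ n"
proof -
  define q where "q = CHAR('k) ^ n"
  define f :: "'k poly" where "f = monom 1 q - monom 1 1"
  have q: "q > 1"
    using assms prime_gt_1_nat[OF assms(1)] unfolding q_def by (intro one_less_power) auto
  have deg: "degree f = q"
    using degree_add_eq_left[of "- monom 1 1" "monom (1::'k) q"] q by (simp add: f_def degree_monom_eq)
  have f0: "f \<noteq> 0" using deg q by auto
  have "(of_nat q :: 'k) = 0"
    using assms(2) by (simp add: q_def of_nat_eq_0_iff_char_dvd)
  then have pd: "pderiv f = -1"
    by (simp add: f_def pderiv_diff pderiv_monom monom_eq_1)
  have sq: "order a f \<le> 1" for a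
  proof (rule ccontr)
    assume "\<not> order a f \<le> 1"
    then have "[:-a, 1:]^2 dvd f" using f0 by (simp add: order_divides)
    then obtain g where g: "f = [:-a, 1:] * ([:-a, 1:] * g)"
      unfolding dvd_def power2_eq_square mult.assoc by blast
    have "poly (pderiv f) a = 0"
      unfolding g by (simp only: pderiv_mult poly_add poly_mult) simp
    then show False by (simp add: pd)
  qed
  have roots: "{x. poly f x = 0} = (finite_subfield q :: 'k set)"
    by (auto simp: f_def finite_subfield_def poly_monom)
  obtain A where A: "size A = q" "f = smult (lead_coeff f) (\<Prod>x\<in>#A. [:-x, 1:])"
    using alg_closed_imp_factorization[OF f0] deg by metis
  have "proots f = A"
  proof -
    have "proots f = proots (\<Prod>x\<in>#A. [:-x, 1:])"
      using f0 by (subst A(2)) simp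
    also have "\<dots> = A"
    proof (induction A)
      case (add x A)
      have "(\<Prod>x\<in>#A. [:-x, 1:]) \<noteq> 0"
        by (auto simp: prod_mset_zero_iff)
      then show ?case
        using add by (simp add: proots_mult del: mult_pCons_left)
    qed simp
    finally show ?thesis .
  qed
  then have "size (proots f) = q" using A(1) by simp
  moreover have "proots f = mset_set {x. poly f x = 0}"
  proof (rule multiset_eqI)
    fix x
    have "order x f = (if poly f x = 0 then 1 else 0)"
      using sq[of x] f0 order_root[of f x] by auto
    then show "count (proots f) x = count (mset_set {x. poly f x = 0}) x"
      using f0 by (simp add: poly_roots_finite)
  qed
  ultimately show ?thesis using roots by (simp add: q_def)
qed

lemma p_integral_of_Ints:
  assumes "p \<noteq> 1" "a \<in> \<int>"
  shows "p_integral p a"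
  using assms by (auto simp: p_integral_def elim!: Ints_cases)

lemma p_integral_model_exists:
  assumes "p \<noteq> 1"
  shows "\<exists>W. p_integral_model p E W"
proof (cases E)
  case (Weierstrass a1 a2 a3 a4 a6)
  define den where "den = (\<lambda>a::rat. rat_of_int (snd (quotient_of a)))"
  have den0: "den a \<noteq> 0" for a
    using quotient_of_denom_pos'[of a] by (simp add: den_def)
  have den_Ints: "den a \<in> \<int>" for a
    by (simp add: den_def)
  have den_mult: "den a * a \<in> \<int>" for a
  proof -
    have "a = rat_of_int (fst (quotient_of a)) / den a"
      unfolding den_def by (intro quotient_of_div) simp
    then have "den a * a = rat_of_int (fst (quotient_of a))"
      using den0[of a] by (simp add: field_simps)
    then show ?thesis by simp
  qed
  define d where "d = den a1 * den a2 * den a3 * den a4 * den a6"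
  have d0: "d \<noteq> 0" by (simp add: d_def den0)
  have dI: "d \<in> \<int>" by (auto simp: d_def intro!: Ints_mult den_Ints)
  have da: "d * a \<in> \<int>" if a: "a \<in> {a1, a2, a3, a4, a6}" for a
  proof -
    have "d * a1 = den a2 * den a3 * den a4 * den a6 * (den a1 * a1)"
      "d * a2 = den a1 * den a3 * den a4 * den a6 * (den a2 * a2)"
      "d * a3 = den a1 * den a2 * den a4 * den a6 * (den a3 * a3)"
      "d * a4 = den a1 * den a2 * den a3 * den a6 * (den a4 * a4)"
      "d * a6 = den a1 * den a2 * den a3 * den a4 * (den a6 * a6)"
      by (simp_all add: d_def)
    then have "d * a1 \<in> \<int>" "d * a2 \<in> \<int>" "d * a3 \<in> \<int>" "d * a4 \<in> \<int>" "d * a6 \<in> \<int>"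
      by (simp_all only: Ints_mult den_Ints den_mult)
    then show ?thesis using a by blast
  qed
  have dpow: "d ^ k * a \<in> \<int>" if a: "a \<in> {a1, a2, a3, a4, a6}" and k: "k > 0" for a k
  proof -
    have "d ^ k * a = d ^ (k - 1) * (d * a)"
      using k by (cases k) simp_all
    then show ?thesis
      using Ints_mult[OF Ints_power[OF dI, of "k - 1"] da[OF a]] by (simp only:)
  qed
  define W where "W = Weierstrass (d * a1) (d^2 * a2) (d^3 * a3) (d^4 * a4) (d^6 * a6)"
  define u where "u = inverse d"
  have u0: "u \<noteq> 0" using d0 by (simp add: u_def)
  have ud: "u ^ k * (d ^ k * a) = a" for k a
    using d0 by (simp add: u_def field_simps)
  have "weierstrass_poly E (u^2 * x + 0) (u^3 * y + u^2 * 0 * x + 0) =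
        u^6 * weierstrass_poly W x y" for x y
  proof -
    have ring: "(u^3 * y)^2 + u * b1 * (u^2 * x) * (u^3 * y) + u^3 * b3 * (u^3 * y)
          - ((u^2 * x)^3 + u^2 * b2 * (u^2 * x)^2 + u^4 * b4 * (u^2 * x) + u^6 * b6) =
        u^6 * (y^2 + b1 * x * y + b3 * y - (x^3 + b2 * x^2 + b4 * x + b6))"
      for b1 b2 b3 b4 b6 :: rat
      by algebra
    show ?thesis
      using ring[of "d * a1" "d^3 * a3" "d^2 * a2" "d^4 * a4" "d^6 * a6"]
        ud[of 1 a1]
      by (simp only: Weierstrass W_def weierstrass_poly.simps ud power_one_right add_0_right
          mult_zero_right mult_zero_left)
  qed
  then have "isomorphic_models E W"
    unfolding isomorphic_models_def using u0 by blast
  moreover have "\<forall>a\<in>set_weierstrass W. a \<in> \<int>"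
    using da[of a1] dpow[of a2 2] dpow[of a3 3] dpow[of a4 4] dpow[of a6 6]
    by (simp add: W_def)
  ultimately show ?thesis
    unfolding p_integral_model_def using p_integral_of_Ints[OF assms] by blast
qed

lemma minimal_model_works:
  assumes "p \<noteq> 1"
  shows "p_integral_model p E (minimal_model p E)"
    and "p_integral_model p E W \<Longrightarrow>
           multiplicity (int p) (fst (quotient_of (discriminant (minimal_model p E)))) \<le>
           multiplicity (int p) (fst (quotient_of (discriminant W)))"
proof -
  obtain W0 where W0: "p_integral_model p E W0"
    using p_integral_model_exists[OF assms] by blast
  show "p_integral_model p E (minimal_model p E)"
    unfolding minimal_model_def using W0 by (rule arg_min_natI)
  show "multiplicity (int p) (fst (quotient_of (discriminant (minimal_model p E)))) \<le>
          multiplicity (int p) (fst (quotient_of (discriminant W)))"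
    if "p_integral_model p E W"
    unfolding minimal_model_def using that by (rule arg_min_nat_le)
qed

end

theory Submission
  imports Defs
begin

text \<open>Write \<open>\<tau> = sqrt p e\<^sup>i\<^sup>\<theta>\<close>, so that \<open>\<alpha>\<^sub>n = cos n\<theta>\<close>.  The traces \<open>\<tau>\<^sup>n + \<tau>'\<^sup>n\<close>, where \<open>\<tau>'\<close> is
  the conjugate of \<open>\<tau>\<close>, are integers congruent to \<open>(\<tau> + \<tau>')\<^sup>n\<close> modulo \<open>p\<close>, hence prime to \<open>p\<close> in the
  ordinary case.  If \<open>\<theta>/2\<pi>\<close> were rational, some \<open>\<tau>\<^sup>n\<close> would be real, and the square of the \<open>n\<close>-th
  trace would be \<open>4p\<^sup>n\<close>.  So \<open>\<theta>/2\<pi>\<close> is irrational, and Kronecker's theorem gives density.  The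
  mean of \<open>cos\<^sup>2 n\<theta>\<close> tends to \<open>1/2\<close>, whereas the second moment of the uniform
  distribution on \<open>[-1,1]\<close> is \<open>1/3\<close>.\<close>

text \<open>The power sums obey a two-term recurrence with coefficients \<open>a\<close> and
  \<open>-q\<close>; modulo \<open>q\<close> only multiplication by \<open>a\<close>
  survives.\<close>

lemma power_sum_eq_power_mod:
  fixes x y :: "'a::comm_ring_1"
  assumes sum: "x + y = of_int a" and prod: "x * y = of_int q" and "n \<ge> 1"
  shows "\<exists>s. x ^ n + y ^ n = of_int s \<and> q dvd s - a ^ n"
  using \<open>n \<ge> 1\<close>
proof (induction n rule: less_induct)
  case (less n)
  have rec: "x ^ Suc (Suc m) + y ^ Suc (Suc m) = (x + y) * (x ^ Suc m + y ^ Suc m) - (x * y) * (x ^ m + y ^ m)"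
    for m by (simp add: algebra_simps)
  consider "n = 1" | "n = 2" | m where "n = Suc (Suc m)" "m \<ge> 1"
    using less.prems by (metis One_nat_def Suc_1 Suc_le_mono le0 le_SucE not0_implies_Suc not_less_eq_eq)
  then show ?case
  proof cases
    case 1
    then show ?thesis using sum by (intro exI[of _ a]) simp
  next
    \<comment> \<open>Exponent 2 is done by hand: the recurrence would call on exponent 0, where the
      power sum is 2 while \<open>a ^ 0 = 1\<close>.\<close>
    case 2
    have "x ^ 2 + y ^ 2 = (x + y) ^ 2 - 2 * (x * y)"
      by (simp add: power2_eq_square algebra_simps)
    then have "x ^ 2 + y ^ 2 = of_int (a ^ 2 - 2 * q)"
      by (simp add: sum prod)
    moreover have "q dvd a ^ 2 - 2 * q - a ^ 2"
      by simp
    ultimately show ?thesis using 2 by blast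
  next
    case 3
    obtain s where s: "x ^ Suc m + y ^ Suc m = of_int s" "q dvd s - a ^ Suc m"
      using less.IH[of "Suc m"] 3 by auto
    obtain t where t: "x ^ m + y ^ m = of_int t"
      using less.IH[of m] 3 by auto
    have "x ^ n + y ^ n = of_int (a * s - q * t)"
      unfolding 3 rec s t sum prod by simp
    moreover have "a * s - q * t - a * a ^ Suc m = a * (s - a ^ Suc m) - q * t"
      by (simp add: algebra_simps)
    then have "q dvd a * s - q * t - a * a ^ Suc m"
      by (metis s(2) dvd_diff dvd_mult dvd_triv_left)
    ultimately show ?thesis unfolding 3 power_Suc by blast
  qed
qed

text \<open>A real power equals its conjugate, so its trace \<open>s\<close> has
  \<open>s ^ 2 = 4 * int p ^ n\<close>. Then \<open>p\<close> divides \<open>s\<close>, hence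
  \<open>a ^ n\<close>, hence \<open>a\<close>.\<close>

lemma ordinary_power_nonreal:
  fixes \<tau> :: complex and p n :: nat
  assumes "prime p" and sum: "\<tau> + cnj \<tau> = of_int a" and prod: "\<tau> * cnj \<tau> = of_nat p"
    and "\<not> int p dvd a" and "n \<ge> 1"
  shows "\<tau> ^ n \<notin> \<real>"
proof
  assume "\<tau> ^ n \<in> \<real>"
  then have real: "cnj \<tau> ^ n = \<tau> ^ n"
    by (metis Reals_cnj_iff complex_cnj_power)
  obtain s where s: "\<tau> ^ n + cnj \<tau> ^ n = of_int s" "int p dvd s - a ^ n"
    using power_sum_eq_power_mod[OF sum, of "int p" n] prod \<open>n \<ge> 1\<close> by auto
  have "of_int (s ^ 2) = (2 * \<tau> ^ n) ^ 2"
    using s(1) real by simp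
  also have "\<dots> = 4 * (\<tau> ^ n * cnj \<tau> ^ n)"
    by (simp add: real power2_eq_square)
  also have "\<dots> = of_int (4 * int p ^ n)"
    by (simp add: prod flip: power_mult_distrib)
  finally have "s ^ 2 = 4 * int p ^ n"
    by (simp only: of_int_eq_iff)
  then have "int p dvd s ^ 2"
    using \<open>n \<ge> 1\<close> by (simp add: dvd_power)
  then have "int p dvd s"
    using prime_dvd_power[of "int p"] \<open>prime p\<close> by simp
  then have "int p dvd a ^ n"
    using dvd_diff[OF _ s(2), of s] by simp
  then show False
    using prime_dvd_power[of "int p"] assms(1,4) by auto
qed

lemma closure_cos_multiples:
  fixes \<theta> :: real
  assumes "\<theta> / (2 * pi) \<notin> \<rat>"
  shows "closure ((\<lambda>n::nat. cos (real n * \<theta>)) ` {1..}) = {-1..1}"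
proof
  show "closure ((\<lambda>n::nat. cos (real n * \<theta>)) ` {1..}) \<subseteq> {-1..1}"
    by (intro closure_minimal) auto
  show "{-1..1} \<subseteq> closure ((\<lambda>n::nat. cos (real n * \<theta>)) ` {1..})"
  proof
    fix x :: real
    assume x: "x \<in> {-1..1}"
    define \<phi> where "\<phi> = arccos x"
    have \<phi>: "cos \<phi> = x" "0 \<le> \<phi>" "\<phi> \<le> pi"
      using x by (auto simp: \<phi>_def arccos_lbound arccos_ubound)
    show "x \<in> closure ((\<lambda>n::nat. cos (real n * \<theta>)) ` {1..})"
      unfolding closure_approachable
    proof (intro allI impI)
      fix e :: real
      assume "e > 0"
      \<comment> \<open>Angles are measured in full turns: the target \<phi> / (2 * pi) lies in
        [0, 1/2], and the tolerance becomes \<open>e\<close> after scaling back.\<close>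
      then obtain k where k: "k > 0"
          "\<bar>frac (real k * (\<theta> / (2 * pi))) - \<phi> / (2 * pi)\<bar> < e / (2 * pi)"
        using Kronecker_approx_1_explicit[OF assms, of "\<phi> / (2 * pi)" "e / (2 * pi)"] \<phi>
        by (auto simp: field_simps)
      define m where "m = \<lfloor>real k * (\<theta> / (2 * pi))\<rfloor>"
      \<comment> \<open>The representative of the angle modulo 2 * pi in [0, 2 * pi).\<close>
      define \<psi> where "\<psi> = real k * \<theta> - 2 * pi * of_int m"
      have "\<psi> - \<phi> = 2 * pi * (frac (real k * (\<theta> / (2 * pi))) - \<phi> / (2 * pi))"
        by (simp add: \<psi>_def m_def frac_def field_simps)
      then have "\<bar>\<psi> - \<phi>\<bar> < e"
        using k(2) by (simp add: abs_mult field_simps)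
      moreover have "\<bar>cos \<psi> - cos \<phi>\<bar> \<le> \<bar>\<psi> - \<phi>\<bar>"
      proof -
        have "\<bar>cos \<psi> - cos \<phi>\<bar> = 2 * (\<bar>sin ((\<psi> + \<phi>) / 2)\<bar> * \<bar>sin ((\<phi> - \<psi>) / 2)\<bar>)"
          by (simp add: cos_diff_cos abs_mult)
        also have "\<dots> \<le> 2 * (1 * \<bar>(\<phi> - \<psi>) / 2\<bar>)"
          by (intro mult_left_mono mult_mono abs_sin_x_le_abs_x) auto
        finally show ?thesis by simp
      qed
      moreover have "cos \<psi> = cos (real k * \<theta>)"
        by (simp add: \<psi>_def cos_diff)
      ultimately show "\<exists>y\<in>(\<lambda>n::nat. cos (real n * \<theta>)) ` {1..}. dist y x < e"
        using k(1) \<phi>(1) by (intro bexI[of _ "cos (real k * \<theta>)"] imageI) (auto simp: dist_real_def)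
    qed
  qed
qed

lemma mean_cos_squared_tendsto:
  fixes \<theta> :: real
  assumes "sin \<theta> \<noteq> 0"
  shows "(\<lambda>N. (\<Sum>n=1..N. (cos (real n * \<theta>))\<^sup>2) / real N) \<longlonglongrightarrow> 1 / 2"
proof -
  have tele: "4 * sin \<theta> * (\<Sum>n=1..N. (cos (real n * \<theta>))\<^sup>2)
      = 2 * sin \<theta> * real N + sin ((2 * real N + 1) * \<theta>) - sin \<theta>" for N
  proof (induction N)
    case (Suc N)
    \<comment> \<open>Doubling the angle turns the product into a difference of sines. At y = (N +
      1) * \<theta> the subtracted sine cancels the boundary term left by the first N
      summands.\<close>
    have "4 * sin \<theta> * (cos y)\<^sup>2 = 2 * sin \<theta> + sin (2 * y + \<theta>) - sin (2 * y - \<theta>)" for y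
      by (simp add: sin_add sin_diff cos_double_cos right_diff_distrib)
    from this[of "real (Suc N) * \<theta>"] show ?case
      using Suc by (simp add: algebra_simps)
  qed simp
  have eq: "(\<Sum>n=1..N. (cos (real n * \<theta>))\<^sup>2) / real N
      = 1 / 2 + (sin ((2 * real N + 1) * \<theta>) - sin \<theta>) / (4 * sin \<theta>) / real N"
    if "N > 0" for N
    using tele[of N] that assms by (simp add: field_simps)
  have "(\<lambda>N. (sin ((2 * real N + 1) * \<theta>) - sin \<theta>) / (4 * sin \<theta>) / real N) \<longlonglongrightarrow> 0"
  proof (rule Lim_null_comparison)
    show "\<forall>\<^sub>F N in sequentially. norm ((sin ((2 * real N + 1) * \<theta>) - sin \<theta>) / (4 * sin \<theta>) / real N)
        \<le> 2 / (4 * \<bar>sin \<theta>\<bar>) / real N"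
    proof (intro always_eventually allI)
      fix N :: nat
      have "\<bar>sin ((2 * real N + 1) * \<theta>) - sin \<theta>\<bar> \<le> 2"
        by (rule order_trans[OF abs_triangle_ineq4])
          (use abs_sin_le_one[of "(2 * real N + 1) * \<theta>"] abs_sin_le_one[of \<theta>] in linarith)
      then show "norm ((sin ((2 * real N + 1) * \<theta>) - sin \<theta>) / (4 * sin \<theta>) / real N)
          \<le> 2 / (4 * \<bar>sin \<theta>\<bar>) / real N"
        unfolding real_norm_def abs_divide abs_mult abs_numeral abs_of_nat
        by (intro divide_right_mono) auto
    qed
    show "(\<lambda>N. 2 / (4 * \<bar>sin \<theta>\<bar>) / real N) \<longlonglongrightarrow> 0"
      by (rule lim_const_over_n)
  qed
  then have "(\<lambda>N. 1 / 2 + (sin ((2 * real N + 1) * \<theta>) - sin \<theta>) / (4 * sin \<theta>) / real N) \<longlonglongrightarrow> 1 / 2 + 0"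
    by (intro tendsto_intros)
  moreover have "\<forall>\<^sub>F N in sequentially.
      1 / 2 + (sin ((2 * real N + 1) * \<theta>) - sin \<theta>) / (4 * sin \<theta>) / real N
        = (\<Sum>n=1..N. (cos (real n * \<theta>))\<^sup>2) / real N"
    using eq by (intro eventually_mono[OF eventually_gt_at_top[of 0]]) simp
  ultimately show ?thesis
    using Lim_transform_eventually by fastforce
qed

text \<open>The constant is the mean of a step function on quarters that dominates the square;
  all that matters is that it is below \<open>1/2\<close>, and thirds would give \<open>14/27\<close>.\<close>

lemma equidistributed_mean_square_le:
  assumes eq: "equidistributed x" and bd: "\<And>n. n \<ge> 1 \<Longrightarrow> \<bar>x n\<bar> \<le> 1"
    and lim: "(\<lambda>N. (\<Sum>n=1..N. (x n)\<^sup>2) / real N) \<longlonglongrightarrow> L"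
  shows "L \<le> 15 / 32"
proof -
  \<comment> \<open>Symmetric intervals suffice, since a square depends only on the absolute value;
    [-t, t] has normalized length t.\<close>
  define I where "I t y = (if y \<in> {-t..t} then 1 else 0 :: real)" for t y :: real
  define D where "D t N = (\<Sum>n=1..N. I t (x n)) / real N" for t and N :: nat
  have D: "D t \<longlonglongrightarrow> t" if "0 \<le> t" "t \<le> 1" for t
  proof -
    have "(\<lambda>N. real (card {n \<in> {1..N}. x n \<in> {-t..t}}) / real N) \<longlonglongrightarrow> (t - (- t)) / 2"
      using eq[unfolded equidistributed_def, rule_format, of "- t" t] that by linarith
    moreover have "real (card {n \<in> {1..N}. x n \<in> {-t..t}}) = (\<Sum>n=1..N. I t (x n))" for N
      by (simp add: I_def sum.If_cases Int_def del: atLeastAtMost_iff)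
    ultimately show ?thesis by (simp add: D_def[abs_def])
  qed
  \<comment> \<open>The weights are the drops between the consecutive squares 1, 9/16, 1/4, 1/16 of
    the quarter points.\<close>
  have step: "y\<^sup>2 \<le> I 1 y - 7/16 * I (3/4) y - 5/16 * I (1/2) y - 3/16 * I (1/4) y"
    if "\<bar>y\<bar> \<le> 1" for y :: real
  proof -
    have "y\<^sup>2 \<le> c\<^sup>2" if "\<bar>y\<bar> \<le> c" for c
      using power_mono[OF that, of 2] by simp
    from this[of 1] this[of "3/4"] this[of "1/2"] this[of "1/4"] show ?thesis
      using that by (auto simp: I_def power2_eq_square abs_le_iff)
  qed
  have "(\<lambda>N. D 1 N - 7/16 * D (3/4) N - 5/16 * D (1/2) N - 3/16 * D (1/4) N)
      \<longlonglongrightarrow> 1 - 7/16 * (3/4) - 5/16 * (1/2) - 3/16 * (1/4)"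
    by (intro tendsto_intros D) auto
  then have upper: "(\<lambda>N. D 1 N - 7/16 * D (3/4) N - 5/16 * D (1/2) N - 3/16 * D (1/4) N) \<longlonglongrightarrow> 15 / 32"
    by simp
  have "(\<Sum>n=1..N. (x n)\<^sup>2) / real N
      \<le> D 1 N - 7/16 * D (3/4) N - 5/16 * D (1/2) N - 3/16 * D (1/4) N" for N
  proof -
    have "(\<Sum>n=1..N. (x n)\<^sup>2) \<le>
        (\<Sum>n=1..N. I 1 (x n) - 7/16 * I (3/4) (x n) - 5/16 * I (1/2) (x n) - 3/16 * I (1/4) (x n))"
      by (intro sum_mono step bd) auto
    then have "(\<Sum>n=1..N. (x n)\<^sup>2) / real N \<le>
        (\<Sum>n=1..N. I 1 (x n) - 7/16 * I (3/4) (x n) - 5/16 * I (1/2) (x n) - 3/16 * I (1/4) (x n)) / real N"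
      by (rule divide_right_mono) simp
    then show ?thesis
      by (simp only: D_def sum_subtractf diff_divide_distrib times_divide_eq_right flip: sum_distrib_left)
  qed
  then show ?thesis
    by (intro LIMSEQ_le[OF lim upper]) blast
qed

text \<open>The mean square tends to 1/2 = 16/32, just above the bound 15/32. The value
  \<open>x 0\<close> is left free because all counts and sums start at 1.\<close>

lemma not_equidistributed_cos_multiples:
  assumes "sin \<theta> \<noteq> 0" and x: "\<And>n. n \<ge> 1 \<Longrightarrow> x n = cos (real n * \<theta>)"
  shows "\<not> equidistributed x"
proof
  assume "equidistributed x"
  moreover have "(\<Sum>n=1..N. (x n)\<^sup>2) = (\<Sum>n=1..N. (cos (real n * \<theta>))\<^sup>2)" for N
    by (intro sum.cong) (auto simp: x)
  then have "(\<lambda>N. (\<Sum>n=1..N. (x n)\<^sup>2) / real N) \<longlonglongrightarrow> 1 / 2"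
    using mean_cos_squared_tendsto[OF assms(1)] by simp
  ultimately have "1 / 2 \<le> (15 / 32 :: real)"
    by (intro equidistributed_mean_square_le[of x]) (simp_all only: x abs_cos_le_one)
  then show False by simp
qed

theorem lemma2p1:
  fixes E :: "rat weierstrass"
    and p :: nat
    and C :: "'k::alg_closed_field weierstrass"
    and \<tau> :: complex
    and \<alpha> :: "nat \<Rightarrow> real"
  assumes "nonsingular (map_weierstrass of_rat E :: complex weierstrass)"
    and "prime p"
    and "CHAR('k) = p"
    and "C = reduction p E"
    and "good_ordinary p C"
    and "\<tau> * cnj \<tau> = of_nat p"
    and "\<forall>n\<ge>1. \<tau> ^ n + cnj \<tau> ^ n = of_nat p ^ n + 1 - of_nat (num_points (p ^ n) C)"
    and "\<forall>n\<ge>1. complex_of_real (\<alpha> n) =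
           (\<tau> ^ n + cnj \<tau> ^ n) / (2 * complex_of_real (real p powr (real n / 2)))"
  shows "closure (\<alpha> ` {1..}) = {-1..1} \<and> \<not> equidistributed \<alpha>"
proof -
  \<comment> \<open>The trace of Frobenius over the prime field, prime to \<open>p\<close> by
    ordinarity.\<close>
  define a where "a = int p + 1 - int (num_points p C)"
  have sum: "\<tau> + cnj \<tau> = of_int a"
    using assms(7)[rule_format, of 1] by (simp add: a_def)
  have ndvd: "\<not> int p dvd a"
    using assms(5) by (simp add: good_ordinary_def a_def)
  note nonreal = ordinary_power_nonreal[OF assms(2) sum assms(6) ndvd]
  have p0: "real p > 0"
    using assms(2) prime_gt_0_nat by simp
  \<comment> \<open>\<open>Arg\<close> may be negative, but the cosine is even, so either conjugate
    serves.\<close>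
  define \<theta> where "\<theta> = Arg \<tau>"
  have "complex_of_real ((cmod \<tau>)\<^sup>2) = complex_of_real (real p)"
    using assms(6) by (simp only: complex_norm_square of_real_of_nat_eq)
  then have norm: "cmod \<tau> = sqrt (real p)"
    by (metis norm_ge_zero of_real_eq_iff real_sqrt_unique)
  have pow: "\<tau> ^ n = rcis (sqrt (real p) ^ n) (real n * \<theta>)" for n
    using rcis_cmod_Arg[of \<tau>] by (metis DeMoivre2 norm \<theta>_def)
  have powr: "real p powr (real n / 2) = sqrt (real p) ^ n" for n
  proof -
    have "sqrt (real p) ^ n = (real p powr (1 / 2)) powr real n"
      using p0 by (simp add: powr_realpow powr_half_sqrt)
    then show ?thesis by (simp add: powr_powr)
  qed
  have \<alpha>: "\<alpha> n = cos (real n * \<theta>)" if "n \<ge> 1" for n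
  proof -
    have "\<tau> ^ n + cnj \<tau> ^ n = complex_of_real (2 * Re (\<tau> ^ n))"
      using complex_add_cnj[of "\<tau> ^ n"] by simp
    also have "\<dots> = complex_of_real (2 * (sqrt (real p) ^ n * cos (real n * \<theta>)))"
      by (simp only: pow Re_rcis)
    finally have "complex_of_real (\<alpha> n) = complex_of_real (cos (real n * \<theta>))"
      using assms(8)[rule_format, OF that] p0 by (simp add: powr)
    then show ?thesis by (simp only: of_real_eq_iff)
  qed
  \<comment> \<open>Up to a positive factor this sine is the imaginary part of \<tau> ^ n. The case
    n = 1 also supplies the nonzero divisor for the mean of squares.\<close>
  have sin: "sin (real n * \<theta>) \<noteq> 0" if "n \<ge> 1" for n
    using nonreal[OF that] by (auto simp: pow complex_is_Real_iff)
  have irrational: "\<theta> / (2 * pi) \<notin> \<rat>"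
  proof
    assume "\<theta> / (2 * pi) \<in> \<rat>"
    then obtain h :: int and k :: nat where k: "k \<noteq> 0" "\<theta> / (2 * pi) = of_int h / real k"
      unfolding Rats_eq_int_div_nat by blast
    then have "real k * \<theta> = of_int (2 * h) * pi"
      by (simp add: field_simps)
    then have "sin (real k * \<theta>) = 0"
      unfolding sin_zero_iff_int2 by blast
    then show False
      using sin[of k] k(1) by simp
  qed
  have "\<alpha> ` {1..} = (\<lambda>n. cos (real n * \<theta>)) ` {1..}"
    by (intro image_cong) (auto simp: \<alpha>)
  then show ?thesis
    using closure_cos_multiples[OF irrational] not_equidistributed_cos_multiples[of \<theta> \<alpha>]
      sin[of 1] \<alpha> by simp
qed

end
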